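(* Consider two locally Lipschitz mappings $F_1:\mathbb{R}^{d_1}\to\mathbb{R}^{d_2}$ and $F_2:\mathbb{R}^{d_2}\to\mathbb{R}^{d_3}$, and define the composition $F=F_2\circ F_1$. Consider two locally bounded, nonempty-valued set-valued mappings $G_1:\mathbb{R}^{d_1}\rightrightarrows\mathbb{R}^{d_2\times d_1}$ and $G_2:\mathbb{R}^{d_2}\rightrightarrows\mathbb{R}^{d_3\times d_2}$ and define $$G(x):=\{A_2A_1: A_1\in G_1(x)\text{ and }A_2\in G_2(F_1(x))\}\qquad\text{for all }x\in\mathbb{R}^{d_1}.$$ Fix a set $\mathcal{Y}_2\subset\mathbb{R}^{d_2}$, define $\mathcal{Y}_1:=F_1^{-1}(\mathcal{Y}_2)$, and let $\bar x\in\mathcal{Y}_1$. Suppose that 1. $(F_1,G_1)$ is $(b)$-regular along $\mathcal{Y}_1$ at $\bar x$ with exponent $1+\eta_1$; 2. $(F_2,G_2)$ is $(b)$-regular along $\mathcal{Y}_2$ at $F_1(\bar x)$ with exponent $1+\eta_2$. Then $(F,G)$ is $(b)$-regular along $\mathcal{Y}_1$ at $\bar x$ with exponent $1+\min\{\eta_1,\eta_2\}$.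
   Context: A set-valued mapping is locally bounded if it maps bounded sets to bounded sets. Definition ($(b)$-regularity): let $F:\mathbb{R}^d\to\mathbb{R}^m$ be locally Lipschitz, $\mathcal{Y}\subseteq\mathbb{R}^d$, $G:\mathbb{R}^d\rightrightarrows\mathbb{R}^{m\times d}$ nonempty-valued, $\bar x\in\mathcal{Y}$, and $\eta>0$. The pair $(F,G)$ is $(b)$-regular along $\mathcal{Y}$ at $\bar x$ with exponent $1+\eta$ if there exists $C>0$ such that $\|F(x)+A(y-x)-F(y)\|\le C\|x-y\|^{1+\eta}$ for all $x$ near $\bar x$, $A\in G(x)$, and $y\in\mathcal{Y}$ near $\bar x$. *)

theory Defs
  imports "HOL-Analysis.Analysis"
begin

definition locally_lipschitz :: "('a::metric_space \<Rightarrow> 'b::metric_space) \<Rightarrow> bool"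
  where "locally_lipschitz F \<longleftrightarrow> (\<forall>x. \<exists>u>0. \<exists>L. L-lipschitz_on (cball x u) F)"

text \<open>The library's \<^const>\<open>local_lipschitz\<close> is for maps with an additional parameter; on
  parameter-independent maps the two notions agree.\<close>

lemma locally_lipschitz_iff_local_lipschitz:
  "locally_lipschitz F \<longleftrightarrow> local_lipschitz (UNIV :: real set) UNIV (\<lambda>_. F)"
proof -
  have "(\<forall>s \<in> cball t u \<inter> UNIV. P) \<longleftrightarrow> P" if "u > 0" for t u :: real and P
    using that centre_in_cball[of t u] by fastforce
  then show ?thesis
    unfolding locally_lipschitz_def local_lipschitz_def
    by (simp cong: conj_cong)
qed

definition locally_bounded :: "('a::metric_space \<Rightarrow> 'b::metric_space set) \<Rightarrow> bool"
  where "locally_bounded G \<longleftrightarrow> (\<forall>B. bounded B \<longrightarrow> bounded (\<Union>x\<in>B. G x))"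

definition nonempty_valued :: "('a \<Rightarrow> 'b set) \<Rightarrow> bool"
  where "nonempty_valued G \<longleftrightarrow> (\<forall>x. G x \<noteq> {})"

text \<open>The parameter \<open>\<eta>\<close> stands for the exponent \<open>1 + \<eta>\<close>. The first four conjuncts are the
  standing assumptions under which the notion is introduced: with them inside the predicate,
  concluding (b)-regularity includes showing that the notion applies.
  One radius \<open>\<epsilon>\<close> serves for both \<open>x\<close> and \<open>y\<close>.\<close>

definition b_regular ::
  "(real^'d \<Rightarrow> real^'m) \<Rightarrow> (real^'d \<Rightarrow> (real^'d^'m) set) \<Rightarrow> (real^'d) set \<Rightarrow> real^'d \<Rightarrow> real \<Rightarrow> bool"
  where "b_regular F G Y xbar \<eta> \<longleftrightarrow>
    locally_lipschitz F \<and> nonempty_valued G \<and> xbar \<in> Y \<and> \<eta> > 0 \<and>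
    (\<exists>C>0. \<exists>\<epsilon>>0. \<forall>x \<in> ball xbar \<epsilon>. \<forall>A \<in> G x. \<forall>y \<in> Y \<inter> ball xbar \<epsilon>.
       norm (F x + A *v (y - x) - F y) \<le> C * norm (x - y) powr (1 + \<eta>))"

end

theory Submission
  imports Defs
begin

text \<open>
  Put \<open>u = F1 x\<close> and \<open>v = F1 y\<close>. The linearisation error of the composition splits exactly as
  the outer error plus the outer linear map applied to the inner error:
  \<open>F2 u + A2 A1 (y - x) - F2 v = (F2 u + A2 (v - u) - F2 v) + A2 (u + A1 (y - x) - v)\<close>.
  The first summand is \<open>O(\<parallel>u - v\<parallel> powr (1 + \<eta>2))\<close>, hence \<open>O(\<parallel>x - y\<parallel> powr (1 + \<eta>2))\<close> because \<open>F1\<close> is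
  Lipschitz near \<open>xbar\<close>. The second is \<open>O(\<parallel>x - y\<parallel> powr (1 + \<eta>1))\<close> because the matrices
  in \<open>G2 (F1 x)\<close> are uniformly bounded for \<open>x\<close> near \<open>xbar\<close>. For \<open>\<parallel>x - y\<parallel> \<le> 1\<close> both powers are at
  most the power with the smaller exponent.
\<close>

text \<open>The norm on matrices is the Euclidean norm of the vector of row norms (the Frobenius norm), so
  this is the Cauchy-Schwarz inequality in every row.\<close>

lemma norm_matrix_vector_mult_le:
  fixes A :: "real^'n^'m" and x :: "real^'n"
  shows "norm (A *v x) \<le> norm A * norm x"
proof -
  have "norm (A *v x) = L2_set (\<lambda>i. norm (A $ i \<bullet> x)) UNIV"
    by (simp add: norm_vec_def matrix_vector_mul_component)
  also have "\<dots> \<le> L2_set (\<lambda>i. norm (A $ i) * norm x) UNIV"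
    by (rule L2_set_mono) (simp_all add: Cauchy_Schwarz_ineq2)
  also have "\<dots> = norm A * norm x"
    by (simp add: norm_vec_def L2_set_left_distrib)
  finally show ?thesis .
qed

text \<open>Near \<open>x\<close> the inner map stays in the ball around \<open>F x\<close> on which the outer map has a Lipschitz
  constant.\<close>

lemma locally_lipschitz_compose:
  assumes F: "locally_lipschitz F" and H: "locally_lipschitz H"
  shows "locally_lipschitz (H \<circ> F)"
  unfolding locally_lipschitz_def
proof
  fix x
  obtain u L where u: "u > 0" and L: "L-lipschitz_on (cball x u) F"
    using F unfolding locally_lipschitz_def by blast
  obtain w M where w: "w > 0" and M: "M-lipschitz_on (cball (F x) w) H"
    using H unfolding locally_lipschitz_def by blast
  have "continuous (at x) F"
    using lipschitz_on_continuous_on[OF lipschitz_on_subset[OF L ball_subset_cball]] u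
    by (simp add: continuous_on_eq_continuous_at)
  then obtain d where d: "d > 0" and Fd: "F ` ball x d \<subseteq> ball (F x) w"
    using w unfolding continuous_at_ball by blast
  define r where "r = min u (d / 2)"
  have "cball x r \<subseteq> cball x u" and "cball x r \<subseteq> ball x d"
    using d by (auto simp: r_def)
  moreover from this(2) have "F ` cball x r \<subseteq> cball (F x) w"
    using Fd ball_subset_cball by blast
  ultimately have "L-lipschitz_on (cball x r) F" and "M-lipschitz_on (F ` cball x r) H"
    using L M by (auto intro: lipschitz_on_subset)
  then have "(M * L)-lipschitz_on (cball x r) (H \<circ> F)"
    by (rule lipschitz_on_compose)
  moreover have "r > 0"
    using u d by (simp add: r_def)
  ultimately show "\<exists>u>0. \<exists>L. L-lipschitz_on (cball x u) (H \<circ> F)"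
    by blast
qed

theorem theorem3p3:
  fixes F1 :: "real^'d1 \<Rightarrow> real^'d2" and F2 :: "real^'d2 \<Rightarrow> real^'d3"
    and G1 :: "real^'d1 \<Rightarrow> (real^'d1^'d2) set" and G2 :: "real^'d2 \<Rightarrow> (real^'d2^'d3) set"
    and Y2 :: "(real^'d2) set" and xbar :: "real^'d1" and \<eta>1 \<eta>2 :: real
  assumes "locally_lipschitz F1" and "locally_lipschitz F2"
    and "locally_bounded G1" and "nonempty_valued G1"
    and "locally_bounded G2" and "nonempty_valued G2"
    and "xbar \<in> F1 -` Y2"
    and "b_regular F1 G1 (F1 -` Y2) xbar \<eta>1"
    and "b_regular F2 G2 Y2 (F1 xbar) \<eta>2"
  shows "b_regular (F2 \<circ> F1) (\<lambda>x. {A2 ** A1 | A1 A2. A1 \<in> G1 x \<and> A2 \<in> G2 (F1 x)})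
           (F1 -` Y2) xbar (min \<eta>1 \<eta>2)"
proof -
  define \<eta> where "\<eta> = min \<eta>1 \<eta>2"
  define G where "G = (\<lambda>x. {A2 ** A1 | A1 A2. A1 \<in> G1 x \<and> A2 \<in> G2 (F1 x)})"
  obtain C1 \<epsilon>1 where \<eta>1: "\<eta>1 > 0" and C1: "C1 > 0" and \<epsilon>1: "\<epsilon>1 > 0" and
    inner: "\<And>x A y. x \<in> ball xbar \<epsilon>1 \<Longrightarrow> A \<in> G1 x \<Longrightarrow> y \<in> (F1 -` Y2) \<inter> ball xbar \<epsilon>1 \<Longrightarrow>
       norm (F1 x + A *v (y - x) - F1 y) \<le> C1 * norm (x - y) powr (1 + \<eta>1)"
    using assms(8) unfolding b_regular_def by blast
  obtain C2 \<epsilon>2 where \<eta>2: "\<eta>2 > 0" and C2: "C2 > 0" and \<epsilon>2: "\<epsilon>2 > 0" and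
    outer: "\<And>u A v. u \<in> ball (F1 xbar) \<epsilon>2 \<Longrightarrow> A \<in> G2 u \<Longrightarrow> v \<in> Y2 \<inter> ball (F1 xbar) \<epsilon>2 \<Longrightarrow>
       norm (F2 u + A *v (v - u) - F2 v) \<le> C2 * norm (u - v) powr (1 + \<eta>2)"
    using assms(9) unfolding b_regular_def by blast
  obtain r L where r: "r > 0" and L: "L-lipschitz_on (cball xbar r) F1"
    using assms(1) unfolding locally_lipschitz_def by blast
  have L0: "L \<ge> 0"
    using L by (rule lipschitz_on_nonneg)
  have "bounded (\<Union>u\<in>ball (F1 xbar) \<epsilon>2. G2 u)"
    using assms(5) unfolding locally_bounded_def by simp
  then obtain M where M: "M > 0" and
    bound: "\<And>u A. u \<in> ball (F1 xbar) \<epsilon>2 \<Longrightarrow> A \<in> G2 u \<Longrightarrow> norm A \<le> M"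
    unfolding bounded_pos by blast
  \<comment> \<open>The bound \<open>1/2\<close> makes any two points of the ball at distance at most \<open>1\<close>; the last
    bound makes \<open>F1\<close> map the ball into the one on which the outer estimate holds.\<close>
  define \<epsilon> where "\<epsilon> = min (min \<epsilon>1 r) (min (1/2) (\<epsilon>2 / (L + 1)))"
  have \<epsilon>: "\<epsilon> > 0" "\<epsilon> \<le> \<epsilon>1" "\<epsilon> \<le> r" "\<epsilon> \<le> 1/2" "\<epsilon> \<le> \<epsilon>2 / (L + 1)"
    using \<epsilon>1 \<epsilon>2 r L0 unfolding \<epsilon>_def
    by (simp_all only: min_less_iff_conj min_le_iff_disj order_refl simp_thms) simp_all
  have lip: "norm (F1 x - F1 y) \<le> L * norm (x - y)"
    if "x \<in> ball xbar \<epsilon>" "y \<in> ball xbar \<epsilon>" for x y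
    using lipschitz_onD[OF L, of x y] that \<epsilon>(3) by (simp add: dist_norm)
  have image: "F1 x \<in> ball (F1 xbar) \<epsilon>2" if x: "x \<in> ball xbar \<epsilon>" for x
  proof -
    have "norm (F1 xbar - F1 x) \<le> L * norm (xbar - x)"
      using lip[of xbar x] x \<epsilon>(1) by simp
    also have "\<dots> \<le> L * \<epsilon>"
      using x L0 by (intro mult_left_mono) (simp_all add: dist_norm)
    also have "\<dots> < (L + 1) * \<epsilon>"
      using \<epsilon>(1) by (simp add: algebra_simps)
    also have "\<dots> \<le> \<epsilon>2"
      using \<epsilon>(5) L0 by (simp add: field_simps)
    finally show ?thesis
      by (simp add: dist_norm)
  qed
  define C where "C = C2 * L powr (1 + \<eta>2) + M * C1"
  have main: "norm (F2 (F1 x) + A *v (y - x) - F2 (F1 y)) \<le> C * norm (x - y) powr (1 + \<eta>)"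
    if x: "x \<in> ball xbar \<epsilon>" and A: "A \<in> G x" and y: "y \<in> (F1 -` Y2) \<inter> ball xbar \<epsilon>" for x A y
  proof -
    obtain A1 A2 where A_eq: "A = A2 ** A1" and A1: "A1 \<in> G1 x" and A2: "A2 \<in> G2 (F1 x)"
      using A unfolding G_def by blast
    have "norm (x - y) \<le> norm (xbar - x) + norm (xbar - y)"
      by (metis dist_norm dist_commute dist_triangle)
    then have n1: "norm (x - y) \<le> 1"
      using x y \<epsilon>(4) by (simp add: dist_norm)
    have smaller: "norm (x - y) powr (1 + \<eta>1) \<le> norm (x - y) powr (1 + \<eta>)"
      "norm (x - y) powr (1 + \<eta>2) \<le> norm (x - y) powr (1 + \<eta>)"
      using n1 by (auto intro!: powr_mono' simp: \<eta>_def)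
    have "norm (F2 (F1 x) + A2 *v (F1 y - F1 x) - F2 (F1 y))
        \<le> C2 * norm (F1 x - F1 y) powr (1 + \<eta>2)"
      using outer[of "F1 x" A2 "F1 y"] image[OF x] image[of y] A2 y by simp
    also have "\<dots> \<le> C2 * (L * norm (x - y)) powr (1 + \<eta>2)"
      using lip[of x y] x y C2 \<eta>2 by (intro mult_left_mono powr_mono2) auto
    also have "\<dots> = C2 * L powr (1 + \<eta>2) * norm (x - y) powr (1 + \<eta>2)"
      using L0 by (simp add: powr_mult)
    also have "\<dots> \<le> C2 * L powr (1 + \<eta>2) * norm (x - y) powr (1 + \<eta>)"
      using C2 smaller(2) by (intro mult_left_mono) auto
    finally have outer_error: "norm (F2 (F1 x) + A2 *v (F1 y - F1 x) - F2 (F1 y))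
        \<le> C2 * L powr (1 + \<eta>2) * norm (x - y) powr (1 + \<eta>)" .
    have "norm (A2 *v (F1 x + A1 *v (y - x) - F1 y))
        \<le> norm A2 * norm (F1 x + A1 *v (y - x) - F1 y)"
      by (rule norm_matrix_vector_mult_le)
    also have "\<dots> \<le> M * (C1 * norm (x - y) powr (1 + \<eta>1))"
      using bound[OF image[OF x] A2] inner[of x A1 y] x y A1 \<epsilon>(2) M
      by (intro mult_mono) auto
    also have "\<dots> \<le> M * C1 * norm (x - y) powr (1 + \<eta>)"
      using M C1 smaller(1) by simp
    finally have inner_error: "norm (A2 *v (F1 x + A1 *v (y - x) - F1 y))
        \<le> M * C1 * norm (x - y) powr (1 + \<eta>)" .
    have "F2 (F1 x) + A *v (y - x) - F2 (F1 y) =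
        (F2 (F1 x) + A2 *v (F1 y - F1 x) - F2 (F1 y)) + A2 *v (F1 x + A1 *v (y - x) - F1 y)"
      unfolding A_eq
      by (simp add: matrix_vector_mul_assoc[symmetric] matrix_vector_right_distrib
          matrix_vector_mult_diff_distrib)
    also have "norm \<dots> \<le> C2 * L powr (1 + \<eta>2) * norm (x - y) powr (1 + \<eta>)
        + M * C1 * norm (x - y) powr (1 + \<eta>)"
      using outer_error inner_error by (rule norm_triangle_mono)
    also have "\<dots> = C * norm (x - y) powr (1 + \<eta>)"
      by (simp add: C_def algebra_simps)
    finally show ?thesis .
  qed
  have "nonempty_valued G"
    using assms(4,6) unfolding nonempty_valued_def G_def by blast
  moreover have "C > 0"
    using C1 C2 M by (simp add: C_def add_nonneg_pos)
  moreover have "\<eta> > 0"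
    using \<eta>1 \<eta>2 by (simp add: \<eta>_def)
  ultimately have "b_regular (F2 \<circ> F1) G (F1 -` Y2) xbar \<eta>"
    unfolding b_regular_def comp_def
    using locally_lipschitz_compose[OF assms(1,2), unfolded comp_def] assms(7) \<epsilon>(1) main by blast
  then show ?thesis
    unfolding G_def \<eta>_def .
qed

end
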